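(* Let $T$ be a rooted tree with $n$ nodes and nonnegative real node weights. For each $k$ with $1 \le k \le n$, there is a maximum-entropy $k$-node summary tree $S$ of $T$ in which, for every node $v$ of $T$ such that $S$ contains a group node $other_v$, the set of children of $v$ represented by $other_v$ is either a prefix or a near-prefix of $\langle v_1, v_2, \ldots, v_{d_v}\rangle$.
   Context: Let $T$ be a rooted tree with nonnegative real weights $w_v$ on its nodes and total weight $W>0$. For a node $v$, $T_v$ denotes the subtree rooted at $v$ and $V(T_v)$ its node set. Summary trees are trees whose nodes are labeled by sets of nodes of $T$, defined recursively. If $T_v$ has one node, the only summary tree for $T_v$ is the single node $\{v\}$. Otherwise a summary tree for $T_v$ is one of: (1) the one-node tree $V(T_v)$; (2) a root $\{v\}$ together with, for each child $x$ of $v$, a summary tree for $T_x$ whose root is made a child of $\{v\}$; (3) a root $\{v\}$, a child node $other_v$ representing a non-empty subset $U_v$ of the children of $v$ together with all their descendants (i.e. the node $\bigcup_{x\in U_v} V(T_x)$), and for each child $x\notin U_v$ of $v$ a summary tree for $T_x$ whose root is made a child of $\{v\}$. A summary tree of $T$ is a summary tree for $T_r$, $r$ the root; a $k$-node summary tree has exactly $k$ nodes. The weight of a summary-tree node is the sum of the weights of the nodes of $T$ it represents. The entropy of a summary tree with node weights $W_1,\ldots,W_k$ is $-\sum_{i=1}^k p_i \lg p_i$ with $p_i = W_i/W$ (and $0\lg 0 = 0$). The size $s_v$ of a node $v$ is the sum of the weights of all nodes of $T_v$; $d_v$ is the number of children of $v$. For each node $v$, fix an ordering $\langle v_1, \ldots,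 v_{d_v}\rangle$ of its children in nondecreasing order of size (ties broken arbitrarily). The prefixes of this sequence are the sets $\{v_1,\ldots,v_i\}$ for $i \ge 0$; the near-prefixes are the sets $\{v_1,\ldots,v_i\}\cup\{v_j\}$ with $i \ge 0$ and $i+2 \le j \le d_v$. *)

theory Defs
  imports Complex_Main
begin

record 'a rtree =
  tree_root :: 'a
  nodes :: "'a set"
  arcs :: "('a \<times> 'a) set"  \<comment> \<open>parent-to-child pairs\<close>

definition rooted_tree :: "'a rtree \<Rightarrow> bool" where
  "rooted_tree T \<longleftrightarrow>
     finite (nodes T) \<and> tree_root T \<in> nodes T \<and> arcs T \<subseteq> nodes T \<times> nodes T \<and>
     (\<forall>u. (u, tree_root T) \<notin> arcs T) \<and>
     (\<forall>v \<in> nodes T - {tree_root T}. \<exists>!u. (u, v) \<in> arcs T) \<and>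
     (\<forall>v \<in> nodes T. (tree_root T, v) \<in> (arcs T)\<^sup>*)"

definition children :: "'a rtree \<Rightarrow> 'a \<Rightarrow> 'a set" where
  "children T v = {x. (v, x) \<in> arcs T}"

definition subtree_nodes :: "'a rtree \<Rightarrow> 'a \<Rightarrow> 'a set" where
  "subtree_nodes T v = {u. (v, u) \<in> (arcs T)\<^sup>*}"

definition subtree_weight :: "'a rtree \<Rightarrow> ('a \<Rightarrow> real) \<Rightarrow> 'a \<Rightarrow> real" where
  "subtree_weight T w v = (\<Sum>u \<in> subtree_nodes T v. w u)"

definition one_node :: "'a \<Rightarrow> 'a rtree" where
  "one_node a = \<lparr>tree_root = a, nodes = {a}, arcs = {}\<rparr>"

definition join :: "'a \<Rightarrow> 'a rtree set \<Rightarrow> 'a rtree" where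
  "join a Ss =
     \<lparr>tree_root = a,
      nodes = insert a (\<Union>S \<in> Ss. nodes S),
      arcs = (\<Union>S \<in> Ss. insert (a, tree_root S) (arcs S))\<rparr>"

text \<open>
  A summary tree is a tree whose nodes are sets of nodes of \<open>T\<close>. These sets are nonempty
  and pairwise disjoint, so nodes can be identified with their labels. If \<open>v\<close> is a leaf, the
  first two rules both produce the single node \<open>{v}\<close> and the third does not apply.
\<close>

inductive summary_tree_at :: "'a rtree \<Rightarrow> 'a \<Rightarrow> 'a set rtree \<Rightarrow> bool" for T where
  collapse: "summary_tree_at T v (one_node (subtree_nodes T v))"
| expand: "summary_tree_at T v (join {v} (S ` children T v))"
    if "\<forall>x \<in> children T v. summary_tree_at T x (S x)"
| expand_other:
    "summary_tree_at T v
       (join {v} (insert (one_node (\<Union>x \<in> U. subtree_nodes T x)) (S ` (children T v - U))))"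
    if "U \<noteq> {}" "U \<subseteq> children T v" "\<forall>x \<in> children T v - U. summary_tree_at T x (S x)"

definition summary_tree :: "'a rtree \<Rightarrow> nat \<Rightarrow> 'a set rtree \<Rightarrow> bool" where
  "summary_tree T k S \<longleftrightarrow> summary_tree_at T (tree_root T) S \<and> card (nodes S) = k"

text \<open>A summand with \<open>p = 0\<close> is \<open>0 * log 2 0 = 0\<close>, whatever the value of \<open>log 2 0\<close>.\<close>

definition entropy :: "'a rtree \<Rightarrow> ('a \<Rightarrow> real) \<Rightarrow> 'a set rtree \<Rightarrow> real" where
  "entropy T w S =
     - (\<Sum>X \<in> nodes S. let p = (\<Sum>u \<in> X. w u) / (\<Sum>u \<in> nodes T. w u) in p * log 2 p)"

definition max_entropy_summary_tree ::
    "'a rtree \<Rightarrow> ('a \<Rightarrow> real) \<Rightarrow> nat \<Rightarrow> 'a set rtree \<Rightarrow> bool" where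
  "max_entropy_summary_tree T w k S \<longleftrightarrow> is_arg_max (entropy T w) (summary_tree T k) S"

text \<open>
  \<open>group_node T S v U\<close>: the summary tree \<open>S\<close> contains a node \<open>other\<^sub>v\<close> representing the set \<open>U\<close>
  of children of \<open>v\<close> and all their descendants. As a labelled tree, a group node for a singleton
  \<open>U = {x}\<close> is the same as the collapsed summary tree for the child \<open>x\<close>, and both count here; this
  is immaterial for the prefix property because every singleton is a prefix or a near-prefix.
\<close>

definition group_node :: "'a rtree \<Rightarrow> 'a set rtree \<Rightarrow> 'a \<Rightarrow> 'a set \<Rightarrow> bool" where
  "group_node T S v U \<longleftrightarrow>
     U \<noteq> {} \<and> U \<subseteq> children T v \<and> ({v}, \<Union>x \<in> U. subtree_nodes T x) \<in> arcs S"

definition size_ordering :: "'a rtree \<Rightarrow> ('a \<Rightarrow> real) \<Rightarrow> 'a \<Rightarrow> 'a list \<Rightarrow> bool" where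
  "size_ordering T w v vs \<longleftrightarrow>
     distinct vs \<and> set vs = children T v \<and> sorted (map (subtree_weight T w) vs)"

definition is_prefix :: "'a set \<Rightarrow> 'a list \<Rightarrow> bool" where
  "is_prefix U vs \<longleftrightarrow> (\<exists>i \<le> length vs. U = set (take i vs))"

text \<open>Positions are counted from 1, so \<open>v\<^sub>j\<close> is \<open>vs ! (j - 1)\<close>.\<close>

definition is_near_prefix :: "'a set \<Rightarrow> 'a list \<Rightarrow> bool" where
  "is_near_prefix U vs \<longleftrightarrow>
     (\<exists>i j. i + 2 \<le> j \<and> j \<le> length vs \<and> U = set (take i vs) \<union> {vs ! (j - 1)})"

end

theory Submission
  imports Defs
begin

text \<open>
  If the set \<open>U\<close> of children grouped at \<open>v\<close> is neither a prefix nor a near-prefix, some child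
  \<open>x\<close> outside \<open>U\<close> precedes two members \<open>a\<close>, \<open>b\<close> of \<open>U\<close> in the size ordering. If the summary tree
  for \<open>x\<close> is a single node, exchanging \<open>x\<close> and \<open>a\<close> makes two node weights more balanced. Otherwise
  take \<open>a\<close> out of \<open>U\<close> as a one-node summary tree and merge two nodes of the summary tree for \<open>x\<close>:
  splitting off \<open>a\<close> gains at least the smaller of the two resulting weights, which is at least the
  size of \<open>x\<close> because \<open>b\<close> stays in the group, while a merge loses at most the merged weight. Either
  way the number of nodes is unchanged and the entropy does not drop. Since the summary trees for the
  remaining children are arbitrary, \<open>U\<close> can be repaired first and the children afterwards.
\<close>

section \<open>The entropy summand\<close>

definition eta :: "real \<Rightarrow> real" where
  "eta t = - (t * log 2 t)"

lemma eta_0 [simp]: "eta 0 = 0"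
  by (simp add: eta_def)

lemma eta_ln: "eta t * ln 2 = - t * ln t"
  by (simp add: eta_def log_def)

text \<open>One summand of Gibbs' inequality, from \<open>ln (s / t) \<le> s / t - 1\<close>. The
  corrections \<open>s - t\<close> cancel when summed over two families of equal total.\<close>

lemma cross_entropy:
  fixes s t :: real
  assumes "0 \<le> t" "0 < s"
  shows "- t * ln t \<le> - t * ln s + (s - t)"
proof (cases "t = 0")
  case False
  with assms have "t * ln (s / t) \<le> t * (s / t - 1)"
    by (intro mult_left_mono ln_le_minus_one) auto
  with False assms show ?thesis
    by (simp add: ln_div algebra_simps)
qed (use assms in auto)

text \<open>Gibbs' inequality bounds the left side by the cross entropy of \<open>(c, d)\<close>
  against \<open>(c', d')\<close>. For \<open>c' \<le> d'\<close> this is at most the right side,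
  since the amount \<open>c' - c\<close> is charged \<open>- ln d'\<close> per unit instead of the
  larger \<open>- ln c'\<close>. The other case is symmetric.\<close>

lemma eta_balance:
  assumes "0 \<le> c" "c \<le> c'" "c \<le> d'" "c' + d' = c + d"
  shows "eta c + eta d \<le> eta c' + eta d'"
proof -
  have main: "eta c + eta d \<le> eta c' + eta d'"
    if "0 \<le> c" "c \<le> c'" "c' \<le> d'" "c' + d' = c + d" for c d c' d'
  proof (cases "c' = 0")
    case True
    with that have "c = 0" "d' = d" by auto
    with True show ?thesis by simp
  next
    case False
    have "- c * ln c \<le> - c * ln c' + (c' - c)"
      using that False by (intro cross_entropy) auto
    moreover have "- d * ln d \<le> - d * ln d' + (d' - d)"
      using that False by (intro cross_entropy) auto
    moreover have "(c' - c) * ln c' \<le> (c' - c) * ln d'"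
      using that False by (intro mult_left_mono) auto
    moreover have "d * ln d' = (d' + (c' - c)) * ln d'" "d' - d = c - c'" using that by auto
    ultimately have "- c * ln c - d * ln d \<le> - c' * ln c' - d' * ln d'"
      unfolding distrib_right left_diff_distrib by linarith
    then have "(eta c + eta d) * ln 2 \<le> (eta c' + eta d') * ln 2"
      by (simp add: distrib_right eta_ln)
    then show ?thesis by simp
  qed
  show ?thesis
    using main[of c c' d' d] main[of c d' c' d] assms by (cases "c' \<le> d'") auto
qed

text \<open>The loss is \<open>p + q\<close> times a binary entropy, hence at most one bit per unit
  of weight. Both parts are compared with their mean \<open>m\<close>.\<close>

lemma eta_merge_loss_le:
  assumes "0 \<le> p" "0 \<le> q"
  shows "eta p + eta q - eta (p + q) \<le> p + q"
proof (cases "p + q = 0")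
  case True
  with assms have "p = 0" "q = 0" by auto
  then show ?thesis by simp
next
  case False
  define m where "m = (p + q) / 2"
  have m: "0 < m" "p + q = 2 * m" using assms False by (auto simp: m_def)
  have "- p * ln p \<le> - p * ln m + (m - p)" "- q * ln q \<le> - q * ln m + (m - q)"
    using assms m by (intro cross_entropy; simp)+
  moreover have "ln m = ln (p + q) - ln 2"
    using m by (simp add: ln_mult)
  moreover have "(m - p) + (m - q) = 0" using m by simp
  ultimately have "- p * ln p - q * ln q + (p + q) * ln (p + q) \<le> (p + q) * ln 2"
    by (simp add: algebra_simps)
  then have "(eta p + eta q - eta (p + q)) * ln 2 \<le> (p + q) * ln 2"
    by (simp add: distrib_right left_diff_distrib eta_ln)
  then show ?thesis by simp
qed

text \<open>For \<open>0 < a \<le> b\<close> the gain is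
  \<open>a * log 2 ((a + b) / a) + b * log 2 ((a + b) / b)\<close>. The first ratio is at least 2
  and the second at least 1, so the gain is at least the smaller part.\<close>

lemma eta_split_gain_ge:
  assumes "0 \<le> s" "s \<le> a" "s \<le> b"
  shows "s \<le> eta a + eta b - eta (a + b)"
proof -
  have main: "a \<le> eta a + eta b - eta (a + b)" if "0 \<le> a" "a \<le> b" for a b
  proof (cases "a = 0")
    case False
    with that have "ln 2 + ln a \<le> ln (a + b)"
      using ln_mono[of "2 * a" "a + b"] by (simp add: ln_mult)
    then have "a * (ln 2 + ln a) \<le> a * ln (a + b)"
      using that by (intro mult_left_mono)
    moreover have "b * ln b \<le> b * ln (a + b)"
      using that False by (intro mult_left_mono) auto
    ultimately have "a * ln 2 \<le> - a * ln a - b * ln b + (a + b) * ln (a + b)"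
      by (simp add: algebra_simps)
    then have "a * ln 2 \<le> (eta a + eta b - eta (a + b)) * ln 2"
      by (simp add: distrib_right left_diff_distrib eta_ln)
    then show ?thesis by simp
  qed simp
  show ?thesis
    using main[of a b] main[of b a] assms by (cases "a \<le> b") (auto simp: add.commute)
qed

section \<open>Prefixes and near-prefixes\<close>

lemma prefix_or_near_prefix_singleton:
  assumes "x \<in> set vs"
  shows "is_prefix {x} vs \<or> is_near_prefix {x} vs"
proof -
  obtain i where i: "i < length vs" "x = vs ! i"
    using assms by (auto simp: in_set_conv_nth)
  show ?thesis
  proof (cases i)
    case 0
    with i have "{x} = set (take 1 vs)" by (cases vs) auto
    with i 0 show ?thesis unfolding is_prefix_def by (intro disjI1 exI[of _ 1]) (auto simp: Suc_le_eq)
  next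
    case (Suc j)
    \<comment> \<open>Index \<open>i\<close> counted from 0 is position \<open>Suc i\<close> counted
      from 1. It is at least 2, as a near-prefix over the empty prefix demands.\<close>
    with i show ?thesis
      unfolding is_near_prefix_def by (intro disjI2 exI[of _ 0] exI[of _ "Suc i"]) auto
  qed
qed

text \<open>Let \<open>l\<close> be the first index whose entry is missing from \<open>U\<close>.
  Then \<open>U\<close> consists of all entries before \<open>l\<close> and some after it. None
  after it would make a prefix and exactly one a near-prefix, so there are at least two.\<close>

lemma not_prefix_or_near_prefix:
  assumes "U \<subseteq> set vs" "\<not> is_prefix U vs" "\<not> is_near_prefix U vs"
  obtains l i j where "l < i" "l < j" "i \<noteq> j" "i < length vs" "j < length vs"
    "vs ! l \<notin> U" "vs ! i \<in> U" "vs ! j \<in> U" "vs ! i \<noteq> vs ! j"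
proof -
  have "\<exists>l < length vs. vs ! l \<notin> U"
  proof (rule ccontr)
    assume "\<not> ?thesis"
    with assms(1) have "U = set (take (length vs) vs)"
      by (auto simp: in_set_conv_nth)
    with assms(2) show False unfolding is_prefix_def by blast
  qed
  then obtain l where l: "l < length vs \<and> vs ! l \<notin> U"
    and "\<And>m. m < l \<Longrightarrow> \<not> (m < length vs \<and> vs ! m \<notin> U)"
    by (subst (asm) exists_least_iff) blast
  then have least: "vs ! m \<in> U" if "m < l" for m
    using that l by (meson order_less_trans)
  have sub: "set (take l vs) \<subseteq> U"
    using least l by (auto simp: in_set_conv_nth)
  have later: "\<exists>i. l < i \<and> i < length vs \<and> y = vs ! i" if y: "y \<in> U" "y \<notin> set (take l vs)" for y
  proof -
    obtain i where i: "i < length vs" "y = vs ! i"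
      using y assms(1) by (auto simp: in_set_conv_nth subset_iff)
    have "\<not> i < l"
      using i y(2) l by (auto simp: in_set_conv_nth)
    moreover have "i \<noteq> l" using i y l by auto
    ultimately show ?thesis using i by (intro exI[of _ i]) auto
  qed
  obtain a where a: "a \<in> U" "a \<notin> set (take l vs)"
    using sub assms(2) l unfolding is_prefix_def by (metis less_imp_le subset_antisym subsetI)
  then obtain i where i: "l < i" "i < length vs" "a = vs ! i"
    using later by blast
  \<comment> \<open>\<open>Suc i\<close> is the position of \<open>a\<close> counted from 1, and
    \<open>l < i\<close> gives \<open>l + 2 \<le> Suc i\<close>.\<close>
  have "U \<noteq> set (take l vs) \<union> {a}"
    using assms(3) i unfolding is_near_prefix_def
    by (metis Suc_leI add_2_eq_Suc' diff_Suc_1 not_less_eq_eq)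
  with a sub obtain b where b: "b \<in> U" "b \<notin> set (take l vs)" "b \<noteq> a"
    by blast
  then obtain j where j: "l < j" "j < length vs" "b = vs ! j"
    using later by blast
  show ?thesis
    using that[of l i j] i j l a b by auto
qed

section \<open>Rooted trees\<close>

locale rooted =
  fixes T :: "'a rtree"
  assumes rooted_tree: "rooted_tree T"
begin

abbreviation sub :: "'a \<Rightarrow> 'a set" where
  "sub \<equiv> subtree_nodes T"

abbreviation kids :: "'a \<Rightarrow> 'a set" where
  "kids \<equiv> children T"

lemma finite_nodes: "finite (nodes T)"
  and root_in_nodes: "tree_root T \<in> nodes T"
  and arcs_subset: "arcs T \<subseteq> nodes T \<times> nodes T"
  using rooted_tree by (auto simp: rooted_tree_def)

lemma unique_parent: "(u, v) \<in> arcs T \<Longrightarrow> (u', v) \<in> arcs T \<Longrightarrow> u = u'"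
  using rooted_tree unfolding rooted_tree_def
  by (metis (no_types, lifting) Diff_iff SigmaD2 singletonD subsetD)

text \<open>Parents are unique, so a cycle through a node also passes through its parent. Along the
  path from the root this would yield a cycle through the root, which no arc enters.\<close>

lemma acyclic_arcs: "acyclic (arcs T)"
proof -
  have no_cycle: "(v, v) \<notin> (arcs T)\<^sup>+" if "(tree_root T, v) \<in> (arcs T)\<^sup>*" for v
    using that
  proof (induction rule: rtrancl_induct)
    case base
    show ?case
      using rooted_tree unfolding rooted_tree_def by (meson tranclE)
  next
    case (step u v)
    show ?case
    proof
      assume "(v, v) \<in> (arcs T)\<^sup>+"
      then obtain u' where "(v, u') \<in> (arcs T)\<^sup>*" "(u', v) \<in> arcs T"
        by (meson tranclD2)
      with step unique_parent have "(u, u) \<in> (arcs T)\<^sup>+"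
        by (metis rtrancl_into_trancl2)
      with step show False by blast
    qed
  qed
  have "(v, v) \<notin> (arcs T)\<^sup>+" for v
  proof
    assume cyc: "(v, v) \<in> (arcs T)\<^sup>+"
    then have "v \<in> nodes T"
      using arcs_subset by (meson SigmaD1 subsetD tranclD)
    with rooted_tree have "(tree_root T, v) \<in> (arcs T)\<^sup>*"
      by (auto simp: rooted_tree_def)
    with no_cycle cyc show False by blast
  qed
  then show ?thesis by (auto simp: acyclic_def)
qed

lemma finite_arcs: "finite (arcs T)"
  using arcs_subset finite_nodes by (meson finite_SigmaI finite_subset)

text \<open>Induction from the leaves upward, well-founded because there are finitely many arcs and
  no cycle.\<close>

lemma children_induct [case_names step]:
  assumes "\<And>v. (\<And>x. x \<in> kids v \<Longrightarrow> P x) \<Longrightarrow> P v"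
  shows "P v"
proof -
  have "wf ((arcs T)\<inverse>)"
    using finite_arcs acyclic_arcs by (rule finite_acyclic_wf_converse)
  then show ?thesis
    by (induction v rule: wf_induct_rule) (auto intro: assms simp: children_def)
qed

lemma children_in_nodes: "x \<in> kids v \<Longrightarrow> x \<in> nodes T"
  using arcs_subset by (auto simp: children_def)

lemma finite_children [simp]: "finite (kids v)"
  using children_in_nodes finite_nodes by (meson finite_subset subsetI)

lemma self_in_sub [simp]: "v \<in> sub v"
  by (simp add: subtree_nodes_def)

lemma sub_unfold: "sub v = insert v (\<Union>x \<in> kids v. sub x)"
  unfolding subtree_nodes_def children_def
  by (auto intro: converse_rtrancl_into_rtrancl elim: converse_rtranclE)

lemma sub_root: "sub (tree_root T) = nodes T"
proof
  have "y \<in> nodes T" if "(tree_root T, y) \<in> (arcs T)\<^sup>*" for y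
    using that by (induction rule: rtrancl_induct) (use root_in_nodes arcs_subset in auto)
  then show "sub (tree_root T) \<subseteq> nodes T" by (auto simp: subtree_nodes_def)
  show "nodes T \<subseteq> sub (tree_root T)"
    using rooted_tree by (auto simp: rooted_tree_def subtree_nodes_def)
qed

lemma sub_subset_nodes:
  assumes "v \<in> nodes T"
  shows "sub v \<subseteq> nodes T"
proof -
  have "(tree_root T, v) \<in> (arcs T)\<^sup>*"
    using assms rooted_tree by (auto simp: rooted_tree_def)
  then show ?thesis
    using sub_root by (auto simp: subtree_nodes_def intro: rtrancl_trans)
qed

lemma finite_sub [simp]: "finite (sub v)"
  by (induction v rule: children_induct) (subst sub_unfold, simp)

lemma root_notin_sub_child:
  assumes "x \<in> kids v"
  shows "v \<notin> sub x"
proof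
  assume "v \<in> sub x"
  with assms have "(v, v) \<in> (arcs T)\<^sup>+"
    by (auto simp: children_def subtree_nodes_def intro: rtrancl_into_trancl2)
  with acyclic_arcs show False by (auto simp: acyclic_def)
qed

text \<open>The last arc of a path from \<open>x\<close> to \<open>y\<close> would leave
  \<open>v\<close>, the only parent of \<open>y\<close>, putting \<open>v\<close> below its own
  child.\<close>

lemma child_notin_sub_sibling:
  assumes "x \<in> kids v" "y \<in> kids v" "x \<noteq> y"
  shows "(x, y) \<notin> (arcs T)\<^sup>*"
proof
  assume "(x, y) \<in> (arcs T)\<^sup>*"
  with \<open>x \<noteq> y\<close> obtain u where "(x, u) \<in> (arcs T)\<^sup>*" "(u, y) \<in> arcs T"
    by (meson rtranclE)
  with assms unique_parent have "v \<in> sub x"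
    by (auto simp: children_def subtree_nodes_def)
  with assms root_notin_sub_child show False by blast
qed

text \<open>Unique parents make any two ancestors of a node comparable, and distinct siblings are
  not.\<close>

lemma sub_siblings_disjoint:
  assumes "x \<in> kids v" "y \<in> kids v" "x \<noteq> y"
  shows "sub x \<inter> sub y = {}"
proof -
  have "single_valued ((arcs T)\<inverse>)"
    using unique_parent by (auto simp: single_valued_def)
  then have "(x, y) \<in> (arcs T)\<^sup>* \<or> (y, x) \<in> (arcs T)\<^sup>*" if "z \<in> sub x" "z \<in> sub y" for z
    using that single_valued_confluent[of "(arcs T)\<inverse>" z x y]
    by (auto simp: subtree_nodes_def rtrancl_converse)
  with assms child_notin_sub_sibling show ?thesis by blast
qed

section \<open>Summary trees\<close>

definition group :: "'a set \<Rightarrow> 'a set" where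
  "group U = (\<Union>x \<in> U. sub x)"

text \<open>Joins the rules \<open>expand\<close> and \<open>expand_other\<close>: an empty
  \<open>U\<close> stands for the absence of a group node, so that one case covers both.\<close>

definition assemble :: "'a \<Rightarrow> 'a set \<Rightarrow> ('a \<Rightarrow> 'a set rtree) \<Rightarrow> 'a set rtree" where
  "assemble v U S =
     join {v} ((if U = {} then {} else {one_node (group U)}) \<union> S ` (kids v - U))"

lemma summary_tree_at_assemble:
  assumes "U \<subseteq> kids v" "\<And>x. x \<in> kids v - U \<Longrightarrow> summary_tree_at T x (S x)"
  shows "summary_tree_at T v (assemble v U S)"
  using assms summary_tree_at.expand[of T v S] summary_tree_at.expand_other[of U T v S]
  by (cases "U = {}") (auto simp: assemble_def group_def)

lemma summary_tree_at_induct [consumes 1, case_names collapse assemble]: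
  assumes "summary_tree_at T v S"
    and "\<And>v. P v (one_node (sub v))"
    and "\<And>v U S. U \<subseteq> kids v \<Longrightarrow> (\<And>x. x \<in> kids v - U \<Longrightarrow> summary_tree_at T x (S x)) \<Longrightarrow>
           (\<And>x. x \<in> kids v - U \<Longrightarrow> P x (S x)) \<Longrightarrow> P v (assemble v U S)"
  shows "P v S"
  using assms(1)
proof (induction rule: summary_tree_at.induct)
  case (expand v S)
  then show ?case using assms(3)[of "{}" v S] by (simp add: assemble_def)
next
  case (expand_other U v S)
  then show ?case using assms(3)[of U v S] by (simp add: assemble_def group_def)
qed (rule assms(2))

section \<open>Labels and sums over the nodes of a summary tree\<close>

lemma union_nodes_summary_tree:
  "summary_tree_at T v S \<Longrightarrow> \<Union>(nodes S) = sub v"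
proof (induction rule: summary_tree_at_induct)
  case (assemble v U S)
  have "\<Union>(nodes (assemble v U S)) = insert v (group U \<union> (\<Union>x \<in> kids v - U. \<Union>(nodes (S x))))"
    by (auto simp: assemble_def join_def one_node_def group_def)
  also have "\<dots> = insert v (group U \<union> group (kids v - U))"
    using assemble.IH by (simp add: group_def)
  also have "\<dots> = sub v"
    using assemble.hyps by (subst sub_unfold) (auto simp: group_def)
  finally show ?case .
qed (simp add: one_node_def)

text \<open>Labels inside disjoint subtrees could coincide only if empty; excluding this keeps the
  nodes of sibling summary trees apart.\<close>

lemma empty_notin_nodes_summary_tree:
  "summary_tree_at T v S \<Longrightarrow> {} \<notin> nodes S"
proof (induction rule: summary_tree_at_induct)
  case (collapse v)
  then show ?case using self_in_sub[of v] by (auto simp: one_node_def simp del: self_in_sub)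
next
  case (assemble v U S)
  have "group U \<noteq> {}" if "U \<noteq> {}"
    using that self_in_sub unfolding group_def by blast
  with assemble show ?case by (auto simp: assemble_def join_def one_node_def)
qed

lemma finite_nodes_summary_tree:
  "summary_tree_at T v S \<Longrightarrow> finite (nodes S)"
  using union_nodes_summary_tree finite_sub by (metis finite_UnionD)

lemma tree_root_summary_tree:
  assumes "summary_tree_at T v S"
  shows "v \<in> tree_root S" "tree_root S \<subseteq> sub v"
  using assms by (cases; simp add: one_node_def join_def)+

text \<open>Labels from different parts are nonempty subsets of disjoint sets, so no node is counted
  twice. \<open>F\<close> is free: the constant 1 gives node counts, \<open>eta\<close> of the
  relative weight gives entropies.\<close>

lemma sum_nodes_assemble:
  fixes F :: "'a set \<Rightarrow> 'b::comm_monoid_add"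
  assumes "U \<subseteq> kids v" "\<And>x. x \<in> kids v - U \<Longrightarrow> summary_tree_at T x (S x)"
  shows "sum F (nodes (assemble v U S)) =
    F {v} + (if U = {} then 0 else F (group U)) + (\<Sum>x \<in> kids v - U. sum F (nodes (S x)))"
proof -
  let ?O = "if U = {} then {} else {group U}" and ?N = "\<Union>x \<in> kids v - U. nodes (S x)"
  have below: "X \<noteq> {} \<and> X \<subseteq> sub x" if "x \<in> kids v - U" "X \<in> nodes (S x)" for x X
    using that assms(2) union_nodes_summary_tree empty_notin_nodes_summary_tree by blast
  have v: "{v} \<notin> ?O \<union> ?N"
  proof -
    have "{v} \<noteq> group U" if y: "y \<in> U" for y
    proof -
      have "y \<in> group U" using y self_in_sub[of y] unfolding group_def by (rule UN_I)
      moreover have "v \<notin> sub y" using y assms(1) by (intro root_notin_sub_child) auto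
      then have "y \<noteq> v" using self_in_sub[of y] by metis
      ultimately show ?thesis by auto
    qed
    moreover have "{v} \<notin> nodes (S x)" if "x \<in> kids v - U" for x
      using below[OF that] root_notin_sub_child[of x v] that by blast
    ultimately show ?thesis by auto
  qed
  have disj: "?O \<inter> ?N = {}"
  proof -
    have "group U \<notin> nodes (S x)" if x: "x \<in> kids v - U" for x
    proof
      assume "group U \<in> nodes (S x)"
      with below x obtain z where "z \<in> group U" "z \<in> sub x" by blast
      then obtain y where "y \<in> U" "z \<in> sub y" "z \<in> sub x" by (auto simp: group_def)
      with x assms(1) sub_siblings_disjoint[of x v y] show False by auto
    qed
    then show ?thesis by auto
  qed
  have fin: "finite ?N"
    using assms(2) finite_nodes_summary_tree by auto
  have "nodes (assemble v U S) = insert {v} (?O \<union> ?N)"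
    by (auto simp: assemble_def join_def one_node_def)
  then have "sum F (nodes (assemble v U S)) = F {v} + (sum F ?O + sum F ?N)"
    using v fin disj by (simp add: sum.union_disjoint)
  moreover have "sum F ?N = (\<Sum>x \<in> kids v - U. sum F (nodes (S x)))"
  proof (rule sum.UNION_disjoint)
    show "\<forall>x \<in> kids v - U. \<forall>y \<in> kids v - U. x \<noteq> y \<longrightarrow> nodes (S x) \<inter> nodes (S y) = {}"
    proof (intro ballI impI)
      fix x y assume xy: "x \<in> kids v - U" "y \<in> kids v - U" "x \<noteq> y"
      then have "sub x \<inter> sub y = {}" using sub_siblings_disjoint[of x v y] by blast
      with below[OF xy(1)] below[OF xy(2)] show "nodes (S x) \<inter> nodes (S y) = {}" by blast
    qed
  qed (use assms(2) finite_nodes_summary_tree in auto)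
  ultimately show ?thesis by (auto simp: add.assoc)
qed

lemma nodes_eq_if_card_1:
  assumes "summary_tree_at T v S" "card (nodes S) = 1"
  shows "nodes S = {sub v}"
  using assms union_nodes_summary_tree by (metis card_1_singletonE cSup_singleton)

text \<open>
  Quantifying over \<open>F\<close> expresses that \<open>S'\<close> arises from \<open>S\<close> by merging the nodes \<open>X\<close> and \<open>Y\<close>;
  it specialises to node counts and to entropies. The proof merges the bottom of \<open>S\<close>, where an
  expanded node has only one-node summary trees below it.
\<close>

lemma summary_tree_merge:
  assumes "summary_tree_at T v S" "card (nodes S) \<noteq> 1"
  shows "\<exists>S' X Y. summary_tree_at T v S' \<and> X \<inter> Y = {} \<and> X \<union> Y \<subseteq> sub v \<and>
    (\<forall>F :: 'a set \<Rightarrow> real. sum F (nodes S') + F X + F Y = sum F (nodes S) + F (X \<union> Y))"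
  using assms
proof (induction rule: summary_tree_at_induct)
  case (collapse v)
  then show ?case by (simp add: one_node_def)
next
  case (assemble v U S)
  show ?case
  proof (cases "\<exists>x \<in> kids v - U. card (nodes (S x)) \<noteq> 1")
    \<comment> \<open>A child tree with several nodes is merged internally by induction; all other
      summands stay.\<close>
    case True
    then obtain x where x: "x \<in> kids v - U" "card (nodes (S x)) \<noteq> 1" by blast
    from assemble.IH[OF this] obtain S' X Y where S': "summary_tree_at T x S'"
      and XY: "X \<inter> Y = {}" "X \<union> Y \<subseteq> sub x"
      and F: "\<And>F :: 'a set \<Rightarrow> real.
        sum F (nodes S') + F X + F Y = sum F (nodes (S x)) + F (X \<union> Y)"
      by blast
    let ?S = "S(x := S')"
    have st: "\<And>y. y \<in> kids v - U \<Longrightarrow> summary_tree_at T y (?S y)"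
      using assemble.hyps S' by auto
    have "(\<Sum>y \<in> kids v - U - {x}. sum F (nodes (?S y))) =
      (\<Sum>y \<in> kids v - U - {x}. sum F (nodes (S y)))" for F :: "'a set \<Rightarrow> real"
      by (intro sum.cong) auto
    then have "sum F (nodes (assemble v U ?S)) + F X + F Y =
      sum F (nodes (assemble v U S)) + F (X \<union> Y)" for F :: "'a set \<Rightarrow> real"
      using F[of F] x(1)
      by (simp only: sum_nodes_assemble[OF assemble.hyps(1) st]
          sum_nodes_assemble[OF assemble.hyps])
        (simp add: sum.remove[of "kids v - U" x])
    moreover have "X \<union> Y \<subseteq> sub v"
      using XY x(1) by (subst sub_unfold) blast
    ultimately show ?thesis
      using summary_tree_at_assemble[OF assemble.hyps(1) st] XY(1) by blast
  next
    case False
    then have one: "nodes (S x) = {sub x}" if "x \<in> kids v - U" for x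
      using that assemble.hyps nodes_eq_if_card_1 by blast
    have flat: "sum F (nodes (assemble v U S)) =
      F {v} + (if U = {} then 0 else F (group U)) + (\<Sum>x \<in> kids v - U. F (sub x))"
      for F :: "'a set \<Rightarrow> real"
      using one by (simp only: sum_nodes_assemble[OF assemble.hyps]) simp
    have kids: "kids v \<noteq> {}"
    proof
      assume "kids v = {}"
      with assemble.hyps(1) have "assemble v U S = join {v} {}" by (simp add: assemble_def)
      with assemble.prems show False by (simp add: join_def)
    qed
    \<comment> \<open>\<open>V\<close> is the group taking part in the merge: \<open>U\<close>
      itself or, without a group node, a single child, whose collapsed tree has the label of a group
      node for it.\<close>
    obtain V where V: "V \<noteq> {}" "V \<subseteq> kids v" and VU: "kids v - V \<subseteq> kids v - U"
      and flatV: "\<And>F :: 'a set \<Rightarrow> real. sum F (nodes (assemble v U S)) =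
        F {v} + F (group V) + (\<Sum>x \<in> kids v - V. F (sub x))"
    proof (cases "U = {}")
      case True
      from kids obtain x where x: "x \<in> kids v" by blast
      have "sum F (nodes (assemble v U S)) =
        F {v} + F (group {x}) + (\<Sum>y \<in> kids v - {x}. F (sub y))" for F :: "'a set \<Rightarrow> real"
        unfolding flat using x True by (simp add: group_def sum.remove[of "kids v" x])
      then show ?thesis using that[of "{x}"] x True by auto
    next
      case False
      then show ?thesis using that[of U] assemble.hyps(1) flat by auto
    qed
    have vg: "{v} \<inter> group V = {}"
      using root_notin_sub_child V by (auto simp: group_def)
    show ?thesis
    \<comment> \<open>If \<open>V\<close> contains all children, the only nodes are
      \<open>{v}\<close> and the group, and merging them collapses the tree. Otherwise one more
      collapsed child joins the group.\<close>
    proof (cases "V = kids v")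
      case True
      then have "{v} \<union> group V = sub v"
        by (subst sub_unfold) (simp add: group_def)
      with True vg flatV show ?thesis
        by (rule_tac x = "one_node (sub v)" in exI, rule_tac x = "{v}" in exI,
            rule_tac x = "group V" in exI)
          (use summary_tree_at.collapse[of T v] in \<open>auto simp: one_node_def\<close>)
    next
      case False
      with V obtain x where x: "x \<in> kids v" "x \<notin> V" by blast
      let ?V = "insert x V"
      have sV: "?V \<subseteq> kids v" using x V by auto
      have st: "\<And>y. y \<in> kids v - ?V \<Longrightarrow> summary_tree_at T y (S y)"
        using assemble.hyps VU by blast
      have "kids v - V - {x} = kids v - ?V" by blast
      then have "(\<Sum>y \<in> kids v - V. F (sub y)) = F (sub x) + (\<Sum>y \<in> kids v - ?V. F (sub y))"
        for F :: "'a set \<Rightarrow> real"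
        using x by (simp add: sum.remove[of "kids v - V" x])
      moreover have "(\<Sum>y \<in> kids v - ?V. sum F (nodes (S y))) = (\<Sum>y \<in> kids v - ?V. F (sub y))"
        for F :: "'a set \<Rightarrow> real"
        using one VU by (intro sum.cong) auto
      moreover have "group ?V = sub x \<union> group V" by (simp add: group_def)
      ultimately have "sum F (nodes (assemble v ?V S)) + F (sub x) + F (group V) =
        sum F (nodes (assemble v U S)) + F (sub x \<union> group V)" for F :: "'a set \<Rightarrow> real"
        by (simp only: sum_nodes_assemble[OF sV st] flatV) simp
      moreover have "sub x \<inter> group V = {}"
        using sub_siblings_disjoint[of x v] x V by (auto simp: group_def)
      moreover have "sub x \<union> group V \<subseteq> sub v"
        using x V by (subst (2) sub_unfold) (auto simp: group_def)
      ultimately show ?thesis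
        using summary_tree_at_assemble[OF sV st] by blast
    qed
  qed
qed

section \<open>Existence of summary trees with every possible number of nodes\<close>

text \<open>Expanding everywhere without group nodes leaves every label a singleton.\<close>

lemma summary_tree_full: "\<exists>S. summary_tree_at T v S \<and> card (nodes S) = card (sub v)"
proof (induction v rule: children_induct)
  case (step v)
  then obtain S where S: "\<And>x. x \<in> kids v \<Longrightarrow> summary_tree_at T x (S x)"
    "\<And>x. x \<in> kids v \<Longrightarrow> card (nodes (S x)) = card (sub x)"
    by metis
  have "card (nodes (assemble v {} S)) = 1 + (\<Sum>x \<in> kids v. card (nodes (S x)))"
    using sum_nodes_assemble[of "{}" v S "\<lambda>_. 1 :: nat"] S(1) by simp
  also have "\<dots> = 1 + (\<Sum>x \<in> kids v. card (sub x))"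
    using S(2) by simp
  also have "\<dots> = 1 + card (\<Union>x \<in> kids v. sub x)"
    using sub_siblings_disjoint by (subst card_UN_disjoint) auto
  also have "\<dots> = card (sub v)"
    using root_notin_sub_child by (subst (2) sub_unfold, subst card_insert_disjoint) auto
  finally show ?case
    using summary_tree_at_assemble[of "{}" v S] S(1) by auto
qed

text \<open>Starting from the fully expanded tree, merges lower the node count one at a
  time.\<close>

lemma summary_tree_exists:
  assumes "1 \<le> k" "k \<le> card (sub v)"
  shows "\<exists>S. summary_tree_at T v S \<and> card (nodes S) = k"
  using assms(2,1)
proof (induction rule: inc_induct)
  case base
  show ?case by (rule summary_tree_full)
next
  case (step m)
  then obtain S where S: "summary_tree_at T v S" "card (nodes S) = Suc m" by auto
  with step.prems have "card (nodes S) \<noteq> 1" by simp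
  then obtain S' X Y where "summary_tree_at T v S'"
    and F: "\<And>F :: 'a set \<Rightarrow> real. sum F (nodes S') + F X + F Y = sum F (nodes S) + F (X \<union> Y)"
    using summary_tree_merge[OF S(1)] by blast
  \<comment> \<open>With the constant 1 for \<open>F\<close>, the merge identity reads
    \<open>card (nodes S') + 2 = card (nodes S) + 1\<close>.\<close>
  with F[of "\<lambda>_. 1"] S(2) show ?case by auto
qed

end

section \<open>Improving a summary tree\<close>

locale weighted_rooted = rooted T for T :: "'a rtree" +
  fixes w :: "'a \<Rightarrow> real" and ord :: "'a \<Rightarrow> 'a list"
  assumes weight_nonneg: "v \<in> nodes T \<Longrightarrow> 0 \<le> w v"
    and total_pos: "0 < (\<Sum>v \<in> nodes T. w v)"
    and ordering: "v \<in> nodes T \<Longrightarrow> size_ordering T w v (ord v)"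
begin

definition mass :: "'a set \<Rightarrow> real" where
  "mass X = (\<Sum>u \<in> X. w u) / (\<Sum>u \<in> nodes T. w u)"

lemma entropy_eq: "entropy T w S = (\<Sum>X \<in> nodes S. eta (mass X))"
  by (simp add: entropy_def eta_def mass_def Let_def sum_negf)

lemma mass_nonneg: "X \<subseteq> nodes T \<Longrightarrow> 0 \<le> mass X"
  unfolding mass_def using weight_nonneg total_pos
  by (intro divide_nonneg_pos sum_nonneg) auto

lemma mass_Un:
  "X \<subseteq> nodes T \<Longrightarrow> Y \<subseteq> nodes T \<Longrightarrow> X \<inter> Y = {} \<Longrightarrow> mass (X \<union> Y) = mass X + mass Y"
  unfolding mass_def using finite_nodes
  by (subst sum.union_disjoint) (auto intro: finite_subset simp: add_divide_distrib)

lemma mass_mono: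
  assumes "X \<subseteq> Y" "Y \<subseteq> nodes T"
  shows "mass X \<le> mass Y"
proof -
  have "mass Y = mass X + mass (Y - X)"
    using mass_Un[of X "Y - X"] assms by (simp add: Un_absorb1 subset_iff)
  moreover have "0 \<le> mass (Y - X)" using assms by (intro mass_nonneg) auto
  ultimately show ?thesis by simp
qed

lemma mass_sub_nth_mono:
  assumes "v \<in> nodes T" "i \<le> j" "j < length (ord v)"
  shows "mass (sub (ord v ! i)) \<le> mass (sub (ord v ! j))"
proof -
  have "subtree_weight T w (ord v ! i) \<le> subtree_weight T w (ord v ! j)"
    using sorted_nth_mono[of "map (subtree_weight T w) (ord v)" i j] ordering assms
    by (auto simp: size_ordering_def)
  then show ?thesis
    using total_pos by (simp add: mass_def subtree_weight_def divide_right_mono)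
qed

lemma mass_group_remove:
  assumes "U \<subseteq> kids v" "a \<in> U"
  shows "mass (group U) = mass (sub a) + mass (group (U - {a}))"
proof -
  have "group U = sub a \<union> group (U - {a})"
    using assms by (auto simp: group_def)
  moreover have "group U \<subseteq> nodes T"
    using assms children_in_nodes sub_subset_nodes by (fastforce simp: group_def)
  moreover have "sub a \<inter> group (U - {a}) = {}"
    using sub_siblings_disjoint[of a v] assms by (auto simp: group_def)
  ultimately show ?thesis using mass_Un by simp
qed

text \<open>The decreasing measure that makes the exchanges at a single node terminate.\<close>

definition rank :: "'a \<Rightarrow> 'a set \<Rightarrow> nat" where
  "rank v U = (\<Sum>i | i < length (ord v) \<and> ord v ! i \<in> U. Suc i)"

text \<open>Both repairs change only the group and the trees for \<open>x\<close> and
  \<open>a\<close>, so node counts and entropies are compared on these parts alone.\<close>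

lemma exchange:
  assumes v: "v \<in> nodes T" and U: "U \<subseteq> kids v"
    and S: "\<And>x. x \<in> kids v - U \<Longrightarrow> summary_tree_at T x (S x)"
    and bad: "\<not> is_prefix U (ord v)" "\<not> is_near_prefix U (ord v)"
  shows "\<exists>U' S'. U' \<subseteq> kids v \<and> (\<forall>x \<in> kids v - U'. summary_tree_at T x (S' x)) \<and>
    card (nodes (assemble v U' S')) = card (nodes (assemble v U S)) \<and>
    entropy T w (assemble v U S) \<le> entropy T w (assemble v U' S') \<and>
    rank v U' < rank v U"
proof -
  have ord: "set (ord v) = kids v" "distinct (ord v)"
    using ordering[OF v] by (auto simp: size_ordering_def)
  have "U \<subseteq> set (ord v)" using U ord by simp
  then obtain l i j where ij: "l < i" "l < j" "i \<noteq> j" "i < length (ord v)" "j < length (ord v)"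
    and lij: "ord v ! l \<notin> U" "ord v ! i \<in> U" "ord v ! j \<in> U" "ord v ! i \<noteq> ord v ! j"
    by (rule not_prefix_or_near_prefix[OF _ bad])
  define x where "x = ord v ! l"
  define a where "a = ord v ! i"
  define b where "b = ord v ! j"
  have x: "x \<in> kids v" "x \<notin> U" and a: "a \<in> U" and b: "b \<in> U" "a \<noteq> b"
    using lij ij ord(1) nth_mem[of l "ord v"] unfolding x_def a_def b_def by auto
  have ak: "a \<in> kids v" using a U by blast
  have xU: "x \<in> kids v - U" using x by blast
  have subs: "sub y \<subseteq> nodes T" if "y \<in> kids v" for y
    using that children_in_nodes sub_subset_nodes by blast
  have groups: "group V \<subseteq> nodes T" if "V \<subseteq> kids v" for V
    using that subs by (auto simp: group_def)
  have xa: "mass (sub x) \<le> mass (sub a)" and xb: "mass (sub x) \<le> mass (sub b)"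
    using mass_sub_nth_mono[OF v, of l] ij unfolding x_def a_def b_def by auto
  have x0: "0 \<le> mass (sub x)" using subs x by (intro mass_nonneg)
  \<comment> \<open>Because \<open>b\<close> stays behind, the group without \<open>a\<close> still
    weighs at least as much as \<open>x\<close>.\<close>
  have rest: "mass (sub b) \<le> mass (group (U - {a}))"
    using b U groups by (intro mass_mono) (auto simp: group_def)
  have split: "mass (group U) = mass (sub a) + mass (group (U - {a}))"
    by (rule mass_group_remove[OF U a])
  let ?I = "{m. m < length (ord v) \<and> ord v ! m \<in> U}"
  have eq_iff: "ord v ! m = ord v ! n \<longleftrightarrow> m = n"
    if "m < length (ord v)" "n < length (ord v)" for m n
    using that ord(2) by (simp add: nth_eq_iff_index_eq)
  have rankU: "rank v U = Suc i + sum Suc (?I - {i})"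
    unfolding rank_def using ij a by (subst sum.remove[of _ i]) (auto simp: x_def a_def b_def)
  have US: "sum F (nodes (assemble v U S)) = F {v} + F (group U) +
    sum F (nodes (S x)) + (\<Sum>y \<in> kids v - U - {x}. sum F (nodes (S y)))"
    for F :: "'a set \<Rightarrow> real"
    using a xU
    by (simp only: sum_nodes_assemble[OF U S]) (auto simp: sum.remove[of "kids v - U" x])
  show ?thesis
  proof (cases "card (nodes (S x)) = 1")
    case True
    let ?U = "insert x (U - {a})" and ?S = "S(a := one_node (sub a))"
    have U': "?U \<subseteq> kids v" using U x by auto
    have S': "summary_tree_at T y (?S y)" if "y \<in> kids v - ?U" for y
      using that S by (auto intro: summary_tree_at.collapse)
    have "kids v - ?U - {a} = kids v - U - {x}" "a \<in> kids v - ?U" using a ak x by auto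
    moreover have "(\<Sum>y \<in> kids v - U - {x}. sum F (nodes (?S y))) =
      (\<Sum>y \<in> kids v - U - {x}. sum F (nodes (S y)))" for F :: "'a set \<Rightarrow> real"
      using a by (intro sum.cong) auto
    ultimately have US': "sum F (nodes (assemble v ?U ?S)) = F {v} + F (group ?U) + F (sub a) +
      (\<Sum>y \<in> kids v - U - {x}. sum F (nodes (S y)))" for F :: "'a set \<Rightarrow> real"
      by (simp only: sum_nodes_assemble[OF U' S'])
        (simp add: sum.remove[of "kids v - ?U" a] one_node_def)
    have Sx: "nodes (S x) = {sub x}" using nodes_eq_if_card_1 S xU True by blast
    show ?thesis
    proof (intro exI[of _ ?U] exI[of _ ?S] conjI)
      show "?U \<subseteq> kids v" by (rule U')
      show "\<forall>y \<in> kids v - ?U. summary_tree_at T y (?S y)" using S' by blast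
      show "card (nodes (assemble v ?U ?S)) = card (nodes (assemble v U S))"
        using US[of "\<lambda>_. 1"] US'[of "\<lambda>_. 1"] Sx by simp
      have "mass (group ?U) = mass (sub x) + mass (group (?U - {x}))"
        by (rule mass_group_remove[OF U']) simp
      moreover have "?U - {x} = U - {a}" using x by auto
      ultimately have "mass (group ?U) = mass (sub x) + mass (group (U - {a}))" by simp
      \<comment> \<open>The weights of \<open>x\<close> and the group are replaced by two weights
        with the same sum, both at least that of \<open>x\<close>.\<close>
      then have "eta (mass (sub x)) + eta (mass (group U)) \<le>
        eta (mass (sub a)) + eta (mass (group ?U))"
        using x0 xa xb rest split by (intro eta_balance) auto
      then show "entropy T w (assemble v U S) \<le> entropy T w (assemble v ?U ?S)"
        using US[of "\<lambda>X. eta (mass X)"] US'[of "\<lambda>X. eta (mass X)"] Sx by (simp add: entropy_eq)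
      \<comment> \<open>Index \<open>l\<close> replaces the larger index \<open>i\<close>, so the
        rank drops.\<close>
      have "{m. m < length (ord v) \<and> ord v ! m \<in> ?U} = insert l (?I - {i})"
        using ij eq_iff x unfolding x_def a_def b_def by auto
      moreover have "l \<notin> ?I - {i}" using x by (simp add: x_def)
      ultimately have "rank v ?U = Suc l + sum Suc (?I - {i})"
        unfolding rank_def by (simp only: sum.insert finite_Diff finite_Collect_conjI
            finite_Collect_less_nat simp_thms)
      with rankU ij show "rank v ?U < rank v U" by simp
    qed
  next
    case False
    obtain R X Y where R: "summary_tree_at T x R"
      and XY: "X \<inter> Y = {}" "X \<union> Y \<subseteq> sub x"
      and F: "\<And>F :: 'a set \<Rightarrow> real. sum F (nodes R) + F X + F Y = sum F (nodes (S x)) + F (X \<union> Y)"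
      using summary_tree_merge[OF S[OF xU] False] by blast
    let ?U = "U - {a}" and ?S = "S(a := one_node (sub a), x := R)"
    have U': "?U \<subseteq> kids v" using U by auto
    have S': "summary_tree_at T y (?S y)" if "y \<in> kids v - ?U" for y
      using that S R by (auto intro: summary_tree_at.collapse)
    \<comment> \<open>The group node survives thanks to \<open>b\<close>, so splitting off
      \<open>a\<close> adds exactly one node and makes up for the merge in the tree for
      \<open>x\<close>.\<close>
    have ne: "?U \<noteq> {}" using b by auto
    have "kids v - ?U - {a} - {x} = kids v - U - {x}" "a \<in> kids v - ?U" "x \<in> kids v - ?U - {a}"
      "x \<noteq> a"
      using a ak x by auto
    moreover have "(\<Sum>y \<in> kids v - U - {x}. sum F (nodes (?S y))) =
      (\<Sum>y \<in> kids v - U - {x}. sum F (nodes (S y)))" for F :: "'a set \<Rightarrow> real"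
      using a by (intro sum.cong) auto
    ultimately have US': "sum F (nodes (assemble v ?U ?S)) = F {v} + F (group ?U) + F (sub a) +
      sum F (nodes R) + (\<Sum>y \<in> kids v - U - {x}. sum F (nodes (S y)))"
      for F :: "'a set \<Rightarrow> real"
      using ne by (simp only: sum_nodes_assemble[OF U' S'])
        (simp add: sum.remove[of "kids v - ?U" a] sum.remove[of "kids v - ?U - {a}" x] one_node_def)
    show ?thesis
    proof (intro exI[of _ ?U] exI[of _ ?S] conjI)
      show "?U \<subseteq> kids v" by (rule U')
      show "\<forall>y \<in> kids v - ?U. summary_tree_at T y (?S y)" using S' by blast
      show "card (nodes (assemble v ?U ?S)) = card (nodes (assemble v U S))"
        using US[of "\<lambda>_. 1"] US'[of "\<lambda>_. 1"] F[of "\<lambda>_. 1"] by simp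
      have XYn: "X \<subseteq> nodes T" "Y \<subseteq> nodes T" using XY(2) subs[OF x(1)] by auto
      have "eta (mass X) + eta (mass Y) - eta (mass (X \<union> Y)) \<le> mass (X \<union> Y)"
        using XYn XY(1) eta_merge_loss_le mass_nonneg by (simp add: mass_Un)
      also have "\<dots> \<le> mass (sub x)" using XY subs x by (intro mass_mono) auto
      also have "\<dots> \<le> eta (mass (sub a)) + eta (mass (group ?U)) - eta (mass (group U))"
        unfolding split using x0 xa xb rest by (intro eta_split_gain_ge) auto
      finally show "entropy T w (assemble v U S) \<le> entropy T w (assemble v ?U ?S)"
        using US[of "\<lambda>X. eta (mass X)"] US'[of "\<lambda>X. eta (mass X)"] F[of "\<lambda>X. eta (mass X)"]
        by (simp add: entropy_eq)
      have "{m. m < length (ord v) \<and> ord v ! m \<in> ?U} = ?I - {i}"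
        using ij eq_iff unfolding x_def a_def b_def by auto
      then have "rank v ?U = sum Suc (?I - {i})"
        unfolding rank_def by simp
      with rankU show "rank v ?U < rank v U" by simp
    qed
  qed
qed

text \<open>Iterates \<open>exchange\<close>, with \<open>rank\<close> ensuring termination. The
  child trees are generalised in the induction because an exchange may rebuild them.\<close>

lemma improve_root:
  assumes "v \<in> nodes T" "U \<subseteq> kids v" "\<forall>x \<in> kids v - U. summary_tree_at T x (S x)"
  shows "\<exists>U' S'. U' \<subseteq> kids v \<and> (\<forall>x \<in> kids v - U'. summary_tree_at T x (S' x)) \<and>
    card (nodes (assemble v U' S')) = card (nodes (assemble v U S)) \<and>
    entropy T w (assemble v U S) \<le> entropy T w (assemble v U' S') \<and>
    (is_prefix U' (ord v) \<or> is_near_prefix U' (ord v))"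
  using assms(2,3)
proof (induction "rank v U" arbitrary: U S rule: less_induct)
  case less
  show ?case
  proof (cases "is_prefix U (ord v) \<or> is_near_prefix U (ord v)")
    case True
    with less.prems show ?thesis by (intro exI[of _ U] exI[of _ S]) auto
  next
    case False
    then obtain U' S' where U': "U' \<subseteq> kids v" "\<forall>x \<in> kids v - U'. summary_tree_at T x (S' x)"
      and eq: "card (nodes (assemble v U' S')) = card (nodes (assemble v U S))"
      and le: "entropy T w (assemble v U S) \<le> entropy T w (assemble v U' S')"
      and rank: "rank v U' < rank v U"
      using exchange[OF assms(1) less.prems(1), of S] less.prems(2) by auto
    from less.hyps[OF rank U'] obtain U2 S2 where "U2 \<subseteq> kids v"
      "\<forall>x \<in> kids v - U2. summary_tree_at T x (S2 x)"
      "card (nodes (assemble v U2 S2)) = card (nodes (assemble v U' S'))"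
      "entropy T w (assemble v U' S') \<le> entropy T w (assemble v U2 S2)"
      "is_prefix U2 (ord v) \<or> is_near_prefix U2 (ord v)"
      by (elim exE conjE)
    with eq le show ?thesis by (intro exI[of _ U2] exI[of _ S2]) auto
  qed
qed

section \<open>From a single node to the whole tree\<close>

text \<open>Ranging over all nodes of \<open>T\<close>, even for a summary tree of a subtree, lets
  the property pass unchanged from child trees to the assembled tree.\<close>

definition good :: "'a set rtree \<Rightarrow> bool" where
  "good S \<longleftrightarrow> (\<forall>v \<in> nodes T. \<forall>U. group_node T S v U \<longrightarrow>
     is_prefix U (ord v) \<or> is_near_prefix U (ord v))"

text \<open>An arc of the assembled tree lies in a child tree, leads to the root of one, or leads to
  the group node. The second kind matters because \<open>group_node\<close> also counts collapsed
  children; there the group is a singleton.\<close>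

lemma good_assemble:
  assumes v: "v \<in> nodes T" and U: "U \<subseteq> kids v" "is_prefix U (ord v) \<or> is_near_prefix U (ord v)"
    and S: "\<And>x. x \<in> kids v - U \<Longrightarrow> summary_tree_at T x (S x)"
    and good: "\<And>x. x \<in> kids v - U \<Longrightarrow> good (S x)"
  shows "good (assemble v U S)"
  unfolding good_def
proof (intro ballI allI impI)
  fix u V
  assume u: "u \<in> nodes T" and gn: "group_node T (assemble v U S) u V"
  have V: "V \<noteq> {}" "V \<subseteq> kids u" and arc: "({u}, group V) \<in> arcs (assemble v U S)"
    using gn by (auto simp: group_node_def group_def)
  \<comment> \<open>No child of \<open>v\<close> lies below another, so a set of children can be
    read off its label: \<open>group\<close> is injective on such sets.\<close>
  have recover: "W = group W \<inter> kids v" if "W \<subseteq> kids v" for W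
  proof -
    have "x \<in> W" if "x \<in> sub y" "y \<in> W" "x \<in> kids v" for x y
      using sub_siblings_disjoint[of x v y] that \<open>W \<subseteq> kids v\<close> self_in_sub[of x] by blast
    with that show ?thesis unfolding group_def using self_in_sub by blast
  qed
  from arc consider
    (below) x where "x \<in> kids v - U" "({u}, group V) \<in> arcs (S x)"
    | (child) x where "x \<in> kids v - U" "u = v" "group V = tree_root (S x)"
    | (other) "u = v" "group V = group U"
    by (auto simp: assemble_def join_def one_node_def split: if_splits)
  then show "is_prefix V (ord u) \<or> is_near_prefix V (ord u)"
  proof cases
    case below
    with V have "group_node T (S x) u V" by (auto simp: group_node_def group_def)
    with good[OF below(1)] u show ?thesis by (auto simp: good_def)
  next
    case child
    have x: "x \<in> kids v" using child by blast
    \<comment> \<open>The root label contains \<open>x\<close> and lies within \<open>sub x\<close>,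
      which forces \<open>V = {x}\<close>.\<close>
    have "group V \<subseteq> group {x}" "x \<in> group V"
      using tree_root_summary_tree[OF S[OF child(1)]] child(3) by (auto simp: group_def)
    with recover[of V] recover[of "{x}"] V child(2) x have "V = {x}" by auto
    moreover have "x \<in> set (ord v)"
      using x ordering[OF v] by (simp add: size_ordering_def)
    ultimately show ?thesis
      using prefix_or_near_prefix_singleton child(2) by simp
  next
    case other
    with recover[of V] recover[of U] V U(1) have "V = U" by simp
    with other U(2) show ?thesis by simp
  qed
qed

lemma improve:
  assumes "v \<in> nodes T" "summary_tree_at T v S"
  shows "\<exists>S'. summary_tree_at T v S' \<and> card (nodes S') = card (nodes S) \<and>
    entropy T w S \<le> entropy T w S' \<and> good S'"
  using assms
proof (induction v arbitrary: S rule: children_induct)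
  case (step v)
  \<comment> \<open>Case analysis through the two-case induction rule, so that both kinds of
    expansion appear as \<open>assemble\<close>.\<close>
  have "S = one_node (sub v) \<or>
    (\<exists>U S0. U \<subseteq> kids v \<and> (\<forall>x \<in> kids v - U. summary_tree_at T x (S0 x)) \<and> S = assemble v U S0)"
    using step.prems(2) by (induction rule: summary_tree_at_induct) blast+
  then consider (collapse) "S = one_node (sub v)"
    | (assemble) U S0 where "U \<subseteq> kids v" "\<forall>x \<in> kids v - U. summary_tree_at T x (S0 x)"
      "S = assemble v U S0"
    by blast
  then show ?case
  proof cases
    case collapse
    then have "good S" by (auto simp: good_def group_node_def one_node_def)
    with step.prems show ?thesis by auto
  next
    case assemble
    from improve_root[OF step.prems(1) assemble(1,2)] obtain U' S1
      where U': "U' \<subseteq> kids v" "is_prefix U' (ord v) \<or> is_near_prefix U' (ord v)"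
        and S1: "\<And>x. x \<in> kids v - U' \<Longrightarrow> summary_tree_at T x (S1 x)"
        and card1: "card (nodes (assemble v U' S1)) = card (nodes S)"
        and ent1: "entropy T w S \<le> entropy T w (assemble v U' S1)"
      unfolding assemble(3) by metis
    \<comment> \<open>From here on \<open>U'\<close> is fixed; improving the child trees does not
      affect the group at \<open>v\<close>.\<close>
    have "\<forall>x \<in> kids v - U'. \<exists>S'. summary_tree_at T x S' \<and> card (nodes S') = card (nodes (S1 x)) \<and>
      entropy T w (S1 x) \<le> entropy T w S' \<and> good S'"
      using step.IH S1 children_in_nodes by blast
    then obtain S2 where S2: "\<And>x. x \<in> kids v - U' \<Longrightarrow> summary_tree_at T x (S2 x)"
      and card2: "\<And>x. x \<in> kids v - U' \<Longrightarrow> card (nodes (S2 x)) = card (nodes (S1 x))"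
      and ent2: "\<And>x. x \<in> kids v - U' \<Longrightarrow> entropy T w (S1 x) \<le> entropy T w (S2 x)"
      and good2: "\<And>x. x \<in> kids v - U' \<Longrightarrow> good (S2 x)"
      by metis
    have "card (nodes (assemble v U' S2)) = card (nodes (assemble v U' S1))"
      using sum_nodes_assemble[OF U'(1) S1, of "\<lambda>_. 1 :: nat"]
        sum_nodes_assemble[OF U'(1) S2, of "\<lambda>_. 1 :: nat"] card2 by simp
    \<comment> \<open>\<open>entropy T w\<close> divides by the total weight of \<open>T\<close> for
      subtrees too, so the entropies of the child trees are summands of the whole and their
      improvements add up.\<close>
    moreover have "entropy T w (assemble v U' S1) \<le> entropy T w (assemble v U' S2)"
      using ent2 unfolding entropy_eq
      by (simp only: sum_nodes_assemble[OF U'(1) S1] sum_nodes_assemble[OF U'(1) S2])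
        (intro add_left_mono sum_mono, simp)
    ultimately show ?thesis
      using summary_tree_at_assemble[OF U'(1) S2] good_assemble[OF step.prems(1) U' S2 good2]
        card1 ent1 by (intro exI[of _ "assemble v U' S2"]) auto
  qed
qed

section \<open>Existence of an optimum\<close>

text \<open>Entropy depends only on the node set, a family of subsets of the finite set
  \<open>nodes T\<close>. So only finitely many values occur, and the largest is attained.\<close>

lemma max_entropy_summary_tree_exists:
  assumes "1 \<le> k" "k \<le> card (nodes T)"
  shows "\<exists>S. max_entropy_summary_tree T w k S"
proof -
  let ?A = "entropy T w ` Collect (summary_tree T k)"
  have "nodes S \<in> Pow (Pow (nodes T))" if "summary_tree T k S" for S
    using that union_nodes_summary_tree[of "tree_root T" S] sub_root
    by (auto simp: summary_tree_def)
  then have "?A \<subseteq> (\<lambda>N. \<Sum>X \<in> N. eta (mass X)) ` Pow (Pow (nodes T))"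
    unfolding entropy_eq by blast
  then have fin: "finite ?A"
    using finite_nodes by (meson finite_Pow_iff finite_imageI finite_subset)
  have "?A \<noteq> {}"
    using summary_tree_exists[of k "tree_root T"] assms sub_root by (auto simp: summary_tree_def)
  with fin have "Max ?A \<in> ?A" by (rule Max_in)
  then obtain S where "summary_tree T k S" "entropy T w S = Max ?A" by auto
  with fin show ?thesis
    unfolding max_entropy_summary_tree_def is_arg_max_def
    by (metis Max_ge image_eqI linorder_not_le mem_Collect_eq)
qed

end

theorem theorem1:
  fixes T :: "'a rtree" and w :: "'a \<Rightarrow> real" and ord :: "'a \<Rightarrow> 'a list" and k :: nat
  assumes "rooted_tree T"
    and "\<forall>v \<in> nodes T. 0 \<le> w v"
    and "0 < (\<Sum>v \<in> nodes T. w v)"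
    and "\<forall>v \<in> nodes T. size_ordering T w v (ord v)"
    and "1 \<le> k" and "k \<le> card (nodes T)"
  shows "\<exists>S. max_entropy_summary_tree T w k S \<and>
           (\<forall>v \<in> nodes T. \<forall>U. group_node T S v U \<longrightarrow>
              is_prefix U (ord v) \<or> is_near_prefix U (ord v))"
proof -
  interpret weighted_rooted T w ord
    using assms by unfold_locales auto
  obtain S where S: "max_entropy_summary_tree T w k S"
    using max_entropy_summary_tree_exists assms by blast
  then have "summary_tree_at T (tree_root T) S" "card (nodes S) = k"
    by (auto simp: max_entropy_summary_tree_def is_arg_max_def summary_tree_def)
  then obtain S' where S': "summary_tree T k S'" "entropy T w S \<le> entropy T w S'" "good S'"
    using improve root_in_nodes unfolding summary_tree_def by metis
  \<comment> \<open>\<open>S'\<close> has as many nodes as the optimum \<open>S\<close> and no less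
    entropy, so it is an optimum too.\<close>
  with S have "max_entropy_summary_tree T w k S'"
    by (auto simp: max_entropy_summary_tree_def is_arg_max_def)
  with S'(3) show ?thesis unfolding good_def by blast
qed

end
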